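(* Let $\widetilde{\mathbf{b}}$ be a generic cost vector such that the linear system $(M\ I)\mathbf{x}=\widetilde{\mathbf{b}}_B$ has a non-negative solution. Then there exists $S\subset\{1,\ldots,d-1\}$ with $|S|\geq\lfloor(d-1)/6\rfloor$ such that, for any $\sigma\subseteq S$, there exists a spanning tree $T_{\sigma}$ of $G_d$ which satisfies the following: (A) $T_{\sigma}$ contains the arc set $\{(i,i+1)\ |\ i\in S\setminus\sigma\}$ and does not contain any arc in $\{(j,j+1)\ |\ j\in\sigma\}$, and (B) $(1,\overline{T_{\sigma}})$ is a standard pair of $in_{\widetilde{\mathbf{b}}}(I_{(I\ -M^{\rm T})})$, where $\overline{T_{\sigma}}:=E\setminus T_{\sigma}$ is the co-tree of $T_{\sigma}$. In particular, since $T_{\sigma}\neq T_{\tau}$ for any distinct $\sigma,\tau\subseteq S$, the initial ideal $in_{\widetilde{\mathbf{b}}}(I_{(I\ -M^{\rm T})})$ has at least $\Omega(2^{\lfloor d/6\rfloor})$ standard pairs for any such generic $\widetilde{\mathbf{b}}$ (i.e. any generic $\widetilde{\mathbf{b}}$ for which $(M\ I)\mathbf{x}=\widetilde{\mathbf{b}}_B$ has a non-negative solution).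
   Context: $G_d=(V,E)$ is the acyclic tournament graph with vertices $1,\ldots,d$ and $n=\binom{d}{2}$ arcs $(i,j)$, $i<j$, directed from $i$ to $j$. The minimum cost flow problem is rewritten with respect to the spanning tree $\{(1,2),(2,3),\ldots,(d-1,d)\}$: $(M\ I)\in\mathbb{Z}^{(d-1)\times n}$ is the fundamental cutset matrix and $(I\ -M^{\rm T})\in\mathbb{Z}^{(n-d+1)\times n}$ is the fundamental circuit matrix for this tree. The vector $\widetilde{\mathbf{b}}=(\widetilde{b}_{i,j})_{1\le i<j\le d}$ has $\widetilde{\mathbf{b}}_B=(\widetilde{b}_{i,i+1})_{1\le i<d}$ and $\widetilde{b}_{i,j}=0$ for $j>i+1$; it is used as a cost vector for the dual problem $\min\{\widetilde{\mathbf{b}}_B^{\rm T}\mathbf{y}''\ |\ I\mathbf{y}'-M^{\rm T}\mathbf{y}''=\widetilde{\mathbf{c}},\ \mathbf{y}',\mathbf{y}''\ge 0\}$ (generic means each integer program in the family has a unique optimum). $I_{(I\ -M^{\rm T})}\subseteq k[x_{i,j}\ |\ 1\le i<j\le d]$ is the toric ideal $\langle \mathbf{x}^{\mathbf{u}}-\mathbf{x}^{\mathbf{v}}\ |\ (I\ -M^{\rm T})\mathbf{u}=(I\ -M^{\rm T})\mathbf{v},\ \mathbf{u},\mathbf{v}\in\mathbb{N}^n\rangle$, whose circuits correspond to the cutsets of $G_d$; $in_{\widetilde{\mathbf{b}}}$ denotes its initial ideal with respect to $\widetilde{\mathbf{b}}$ (a term order under the non-negativity condition). A standard pair $(\mathbf{x}^{\mathbf{a}},\sigma)$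 of an initial ideal is a monomial and index set with $\mathrm{supp}(\mathbf{a})\cap\sigma=\emptyset$, all monomials in $\mathbf{x}^{\mathbf{a}}k[x_j\ |\ j\in\sigma]$ outside the initial ideal, and maximal with respect to this property. For $\sigma\subseteq E$, $\mathbf{x}^{\sigma}:=\prod_{(i,j)\in\sigma}x_{i,j}$; $(1,\sigma)$ is a standard pair iff $\sigma$ is a co-tree of $G_d$ with $\mathbf{x}^{\sigma}\notin in_{\widetilde{\mathbf{b}}}(I_{(I\ -M^{\rm T})})$. *)

theory Defs
  imports Complex_Main "HOL-Library.Poly_Mapping" "HOL-Algebra.Ideal"
begin

section \<open>Polynomials, monomials, ideals\<close>

abbreviation keys :: "('a \<Rightarrow>\<^sub>0 'b::zero) \<Rightarrow> 'a set" where "keys \<equiv> Poly_Mapping.keys"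

abbreviation lookup :: "('a \<Rightarrow>\<^sub>0 'b::zero) \<Rightarrow> 'a \<Rightarrow> 'b" where "lookup \<equiv> Poly_Mapping.lookup"

text \<open>Exponent vectors are finitely supported maps to \<^typ>\<open>nat\<close>. The ring \<open>k[x\<^sub>v | v \<in> X]\<close> is the
  subring of those polynomials all of whose monomials only involve variables in \<open>X\<close>.\<close>

type_synonym ('v, 'k) mpoly = "('v \<Rightarrow>\<^sub>0 nat) \<Rightarrow>\<^sub>0 'k"

definition mpoly_ring :: "'v set \<Rightarrow> (('v, 'k::field) mpoly) ring" where
  "mpoly_ring X = \<lparr>carrier = {p. \<forall>m\<in>keys p. keys m \<subseteq> X},
     monoid.mult = (*), one = 1, ring.zero = 0, add = (+)\<rparr>"

definition xpow :: "('v \<Rightarrow>\<^sub>0 nat) \<Rightarrow> ('v, 'k::field) mpoly" where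
  "xpow u = Poly_Mapping.single u 1"

definition weight :: "('v \<Rightarrow> real) \<Rightarrow> ('v \<Rightarrow>\<^sub>0 nat) \<Rightarrow> real" where
  "weight w u = (\<Sum>v\<in>keys u. w v * real (lookup u v))"

text \<open>The initial form is the sum of all terms of maximal weight; no tie-breaking order is involved.
  For a generic weight the initial ideal is nevertheless a monomial ideal.\<close>

definition initial_form :: "('v \<Rightarrow> real) \<Rightarrow> ('v, 'k::field) mpoly \<Rightarrow> ('v, 'k) mpoly" where
  "initial_form w f =
     (\<Sum>m\<in>{m \<in> keys f. weight w m = Max (weight w ` keys f)}. Poly_Mapping.single m (lookup f m))"

definition initial_ideal ::
    "'v set \<Rightarrow> ('v \<Rightarrow> real) \<Rightarrow> ('v, 'k::field) mpoly set \<Rightarrow> ('v, 'k) mpoly set" where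
  "initial_ideal X w J = Idl\<^bsub>mpoly_ring X\<^esub> (initial_form w ` J)"

section \<open>Standard pairs\<close>

definition pair_monomials :: "('v \<Rightarrow>\<^sub>0 nat) \<Rightarrow> 'v set \<Rightarrow> ('v, 'k::field) mpoly set" where
  "pair_monomials a \<sigma> = {xpow (a + b) | b. keys b \<subseteq> \<sigma>}"

definition admissible_pair ::
    "'v set \<Rightarrow> ('v, 'k::field) mpoly set \<Rightarrow> ('v \<Rightarrow>\<^sub>0 nat) \<Rightarrow> 'v set \<Rightarrow> bool" where
  "admissible_pair X J a \<sigma> \<longleftrightarrow>
     keys a \<subseteq> X \<and> \<sigma> \<subseteq> X \<and> keys a \<inter> \<sigma> = {} \<and> pair_monomials a \<sigma> \<inter> J = {}"

text \<open>Maximality is with respect to inclusion of the sets of monomials \<open>x\<^sup>a k[x\<^sub>j | j \<in> \<sigma>]\<close>.\<close>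

definition standard_pairs ::
    "'v set \<Rightarrow> ('v, 'k::field) mpoly set \<Rightarrow> (('v, 'k) mpoly \<times> 'v set) set" where
  "standard_pairs X J = {(xpow a, \<sigma>) | a \<sigma>. admissible_pair X J a \<sigma> \<and>
     (\<forall>b \<tau>. admissible_pair X J b \<tau> \<and>
        (pair_monomials a \<sigma> :: ('v, 'k) mpoly set) \<subseteq> pair_monomials b \<tau> \<longrightarrow> b = a \<and> \<tau> = \<sigma>)}"

section \<open>Integer matrices, toric ideals, generic costs\<close>

text \<open>A matrix with rows \<open>R\<close> and columns \<open>E\<close> is a function of a row and a column index; its values
  outside \<open>R \<times> E\<close> are irrelevant.\<close>

definition mat_vec :: "'v set \<Rightarrow> ('r \<Rightarrow> 'v \<Rightarrow> int) \<Rightarrow> ('v \<Rightarrow>\<^sub>0 nat) \<Rightarrow> 'r \<Rightarrow> int" where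
  "mat_vec E A u r = (\<Sum>e\<in>E. A r e * int (lookup u e))"

definition toric_ideal ::
    "'r set \<Rightarrow> 'v set \<Rightarrow> ('r \<Rightarrow> 'v \<Rightarrow> int) \<Rightarrow> ('v, 'k::field) mpoly set" where
  "toric_ideal R E A = Idl\<^bsub>mpoly_ring E\<^esub> {xpow u - xpow v | u v.
     keys u \<subseteq> E \<and> keys v \<subseteq> E \<and> (\<forall>r\<in>R. mat_vec E A u r = mat_vec E A v r)}"

definition ip_feasible ::
    "'r set \<Rightarrow> 'v set \<Rightarrow> ('r \<Rightarrow> 'v \<Rightarrow> int) \<Rightarrow> ('r \<Rightarrow> int) \<Rightarrow> ('v \<Rightarrow>\<^sub>0 nat) set" where
  "ip_feasible R E A c = {u. keys u \<subseteq> E \<and> (\<forall>r\<in>R. mat_vec E A u r = c r)}"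

text \<open>The family of integer programs \<open>min {w u | A u = c, u \<in> \<nat>\<^sup>E}\<close> consists of those with a
  right-hand side \<open>c\<close> for which the program is feasible.\<close>

definition generic_cost :: "'r set \<Rightarrow> 'v set \<Rightarrow> ('r \<Rightarrow> 'v \<Rightarrow> int) \<Rightarrow> ('v \<Rightarrow> real) \<Rightarrow> bool" where
  "generic_cost R E A w \<longleftrightarrow> (\<forall>c. ip_feasible R E A c \<noteq> {} \<longrightarrow>
     (\<exists>!u. u \<in> ip_feasible R E A c \<and> (\<forall>v\<in>ip_feasible R E A c. weight w u \<le> weight w v)))"

section \<open>The acyclic tournament graph\<close>

type_synonym arc = "nat \<times> nat"

definition arcs :: "nat \<Rightarrow> arc set" where
  "arcs d = {(i, j). 1 \<le> i \<and> i < j \<and> j \<le> d}"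

text \<open>Connectedness and cycles refer to the underlying undirected graph; as there are no loops or
  parallel arcs, a cycle has at least three vertices.\<close>

definition is_cycle :: "arc set \<Rightarrow> nat list \<Rightarrow> bool" where
  "is_cycle T vs \<longleftrightarrow> length vs \<ge> 3 \<and> distinct vs \<and>
     (\<forall>i<length vs. (vs ! i, vs ! (Suc i mod length vs)) \<in> T \<union> T\<inverse>)"

definition spanning_tree :: "nat \<Rightarrow> arc set \<Rightarrow> bool" where
  "spanning_tree d T \<longleftrightarrow> T \<subseteq> arcs d \<and>
     (\<forall>u\<in>{1..d}. \<forall>v\<in>{1..d}. (u, v) \<in> (T \<union> T\<inverse>)\<^sup>*) \<and> \<not> (\<exists>vs. is_cycle T vs)"

text \<open>Deleting \<open>e\<close> from the tree \<open>T\<close> splits the vertices into the side of the tail of \<open>e\<close> and the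
  side of its head. The fundamental cutset of \<open>e\<close> consists of the arcs between the two sides,
  signed by their direction relative to \<open>e\<close>.\<close>

definition tail_side :: "arc set \<Rightarrow> arc \<Rightarrow> nat set" where
  "tail_side T e = ((T - {e}) \<union> (T - {e})\<inverse>)\<^sup>* `` {fst e}"

definition fund_cutset :: "arc set \<Rightarrow> arc \<Rightarrow> arc \<Rightarrow> int" where
  "fund_cutset T e f =
     (if fst f \<in> tail_side T e \<and> snd f \<notin> tail_side T e then 1
      else if fst f \<notin> tail_side T e \<and> snd f \<in> tail_side T e then -1 else 0)"

definition path_tree :: "nat \<Rightarrow> arc set" where
  "path_tree d = {(i, i + 1) | i. 1 \<le> i \<and> i < d}"

definition M :: "nat \<Rightarrow> arc \<Rightarrow> arc \<Rightarrow> int" where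
  "M d e f = fund_cutset (path_tree d) e f"

text \<open>\<open>(M I)\<close> has rows \<open>path_tree d\<close> and \<open>(I -M\<^sup>T)\<close> has rows \<open>arcs d - path_tree d\<close>; both have
  columns \<open>arcs d\<close>.\<close>

definition cutset_mat :: "nat \<Rightarrow> arc \<Rightarrow> arc \<Rightarrow> int" where
  "cutset_mat d e f = (if f \<in> path_tree d then (if f = e then 1 else 0) else M d e f)"

definition circuit_mat :: "nat \<Rightarrow> arc \<Rightarrow> arc \<Rightarrow> int" where
  "circuit_mat d g f = (if f \<in> path_tree d then - M d f g else (if f = g then 1 else 0))"

definition dual_cost :: "nat \<Rightarrow> (arc \<Rightarrow> real) \<Rightarrow> bool" where
  "dual_cost d b \<longleftrightarrow> (\<forall>e\<in>arcs d - path_tree d. b e = 0)"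

definition dual_generic :: "nat \<Rightarrow> (arc \<Rightarrow> real) \<Rightarrow> bool" where
  "dual_generic d b \<longleftrightarrow> generic_cost (arcs d - path_tree d) (arcs d) (circuit_mat d) b"

definition nonneg_solvable :: "nat \<Rightarrow> (arc \<Rightarrow> real) \<Rightarrow> bool" where
  "nonneg_solvable d b \<longleftrightarrow> (\<exists>x :: arc \<Rightarrow> real. (\<forall>f\<in>arcs d. 0 \<le> x f) \<and>
     (\<forall>e\<in>path_tree d. (\<Sum>f\<in>arcs d. of_int (cutset_mat d e f) * x f) = b e))"

definition dual_toric_ideal :: "nat \<Rightarrow> (arc, 'k::field) mpoly set" where
  "dual_toric_ideal d = toric_ideal (arcs d - path_tree d) (arcs d) (circuit_mat d)"

definition dual_standard_pairs ::
    "nat \<Rightarrow> (arc \<Rightarrow> real) \<Rightarrow> ((arc, 'k::field) mpoly \<times> arc set) set" where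
  "dual_standard_pairs d b =
     standard_pairs (arcs d) (initial_ideal (arcs d) b (dual_toric_ideal d))"

section \<open>Consistency of the definitions\<close>

lemma keys_mult_vars:
  assumes "\<forall>m\<in>keys p. keys m \<subseteq> X" "\<forall>m\<in>keys q. keys m \<subseteq> X"
  shows "\<forall>m\<in>keys (p * q). keys (m :: 'v \<Rightarrow>\<^sub>0 nat) \<subseteq> X"
proof
  fix m assume "m \<in> keys (p * q)"
  then obtain a b where "a \<in> keys p" "b \<in> keys q" "m = a + b"
    using keys_mult[of p q] by blast
  then show "keys m \<subseteq> X" using assms keys_add[of a b] by blast
qed

lemma mpoly_ring_cring: "cring (mpoly_ring X :: (('v, 'k::field) mpoly) ring)"
proof (rule cringI)
  show "abelian_group (mpoly_ring X :: (('v, 'k) mpoly) ring)"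
  proof (rule abelian_groupI)
    fix x :: "('v, 'k) mpoly" assume x: "x \<in> carrier (mpoly_ring X)"
    then have "- x \<in> carrier (mpoly_ring X)" "- x \<oplus>\<^bsub>mpoly_ring X\<^esub> x = \<zero>\<^bsub>mpoly_ring X\<^esub>"
      by (auto simp: mpoly_ring_def)
    then show "\<exists>y\<in>carrier (mpoly_ring X). y \<oplus>\<^bsub>mpoly_ring X\<^esub> x = \<zero>\<^bsub>mpoly_ring X\<^esub>"
      by blast
  next
    fix x y :: "('v, 'k) mpoly"
    assume "x \<in> carrier (mpoly_ring X)" "y \<in> carrier (mpoly_ring X)"
    then show "x \<oplus>\<^bsub>mpoly_ring X\<^esub> y \<in> carrier (mpoly_ring X)"
      using keys_add[of x y] by (auto simp: mpoly_ring_def)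
  qed (auto simp: mpoly_ring_def add_ac)
next
  show "Group.comm_monoid (mpoly_ring X :: (('v, 'k) mpoly) ring)"
  proof (rule comm_monoidI)
    fix x y :: "('v, 'k) mpoly"
    assume "x \<in> carrier (mpoly_ring X)" "y \<in> carrier (mpoly_ring X)"
    then show "x \<otimes>\<^bsub>mpoly_ring X\<^esub> y \<in> carrier (mpoly_ring X)"
      using keys_mult_vars[of x X y] by (simp add: mpoly_ring_def)
  qed (auto simp: mpoly_ring_def mult.assoc mult.commute)
next
  fix x y z :: "('v, 'k) mpoly"
  show "(x \<oplus>\<^bsub>mpoly_ring X\<^esub> y) \<otimes>\<^bsub>mpoly_ring X\<^esub> z =
    x \<otimes>\<^bsub>mpoly_ring X\<^esub> z \<oplus>\<^bsub>mpoly_ring X\<^esub> y \<otimes>\<^bsub>mpoly_ring X\<^esub> z"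
    by (simp add: mpoly_ring_def distrib_right)
qed

lemma path_tree_side:
  assumes "1 \<le> k" "k < d"
  shows "tail_side (path_tree d) (k, k + 1) = {1..k}"
proof -
  let ?T = "path_tree d - {(k, k + 1)}"
  have sub: "y \<in> {1..k}" if "(k, y) \<in> (?T \<union> ?T\<inverse>)\<^sup>*" for y
    using that assms by (induction rule: rtrancl_induct) (auto simp: path_tree_def)
  have sup: "(k, k - n) \<in> (?T \<union> ?T\<inverse>)\<^sup>*" if "n < k" for n
    using that
  proof (induction n)
    case (Suc n)
    then have "(k - Suc n, k - n) \<in> ?T" using assms by (auto simp: path_tree_def)
    then show ?case using Suc by (meson Suc_lessD UnI2 converseI rtrancl.rtrancl_into_rtrancl)
  qed simp
  show ?thesis
  proof
    show "tail_side (path_tree d) (k, k + 1) \<subseteq> {1..k}"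
      using sub by (auto simp: tail_side_def)
    show "{1..k} \<subseteq> tail_side (path_tree d) (k, k + 1)"
    proof
      fix y assume "y \<in> {1..k}"
      then show "y \<in> tail_side (path_tree d) (k, k + 1)"
        using sup[of "k - y"] by (auto simp: tail_side_def)
    qed
  qed
qed

lemma M_path_tree:
  assumes "1 \<le> k" "k < d" "(i, j) \<in> arcs d"
  shows "M d (k, k + 1) (i, j) = (if i \<le> k \<and> k < j then 1 else 0)"
  unfolding M_def fund_cutset_def path_tree_side[OF assms(1,2)]
  using assms by (auto simp: arcs_def)

end

theory Submission
  imports Defs
begin

text \<open>Write \<open>b\<^sub>k\<close> for the cost of \<open>(k, k + 1)\<close>; a non-negative solution exists iff all
  \<open>b\<^sub>k\<close> are non-negative. By linear programming duality, \<open>(1, E \ T)\<close> is a standard pair as soon as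
  the flow problem has a non-negative solution supported on the spanning tree \<open>T\<close>. The path carries
  the solution \<open>x\<^sub>k\<^sub>,\<^sub>k\<^sub>+\<^sub>1 = b\<^sub>k\<close>. If \<open>b\<^sub>k \<le> b\<^sub>k\<^sub>+\<^sub>1\<close>, then sending \<open>b\<^sub>k\<close> along
  \<open>(k, k + 2)\<close> empties \<open>(k, k + 1)\<close> and leaves \<open>b\<^sub>k\<^sub>+\<^sub>1 - b\<^sub>k\<close> on \<open>(k + 1, k + 2)\<close>, and
  symmetrically if \<open>b\<^sub>k\<^sub>+\<^sub>1 \<le> b\<^sub>k\<close>. These exchanges are independent for the disjoint pairs
  \<open>{1, 2}, {3, 4}, \<dots>\<close> of cuts, so that \<open>S\<close> may consist of the cheaper cut of each pair; it even has
  \<open>\<lfloor>(d - 1) / 2\<rfloor>\<close> elements.\<close>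

section \<open>Initial ideals of toric ideals\<close>

definition lin_ext :: "('a \<Rightarrow> 'b) \<Rightarrow> ('a \<Rightarrow>\<^sub>0 'b::comm_ring_1) \<Rightarrow> 'b" where
  "lin_ext h p = (\<Sum>m\<in>keys p. lookup p m * h m)"

lemma lin_ext_superset:
  assumes "finite A" "keys p \<subseteq> A"
  shows "lin_ext h p = (\<Sum>m\<in>A. lookup p m * h m)"
  unfolding lin_ext_def using assms
  by (intro sum.mono_neutral_left) (auto simp: in_keys_iff)

lemma lin_ext_zero: "lin_ext h 0 = 0"
  by (simp add: lin_ext_def)

lemma lin_ext_single: "lin_ext h (Poly_Mapping.single m c) = c * h m"
  by (subst lin_ext_superset[of "{m}"]) auto

lemma lin_ext_add: "lin_ext h (p + q) = lin_ext h p + lin_ext h q"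
proof -
  let ?A = "keys p \<union> keys q"
  show ?thesis
    using keys_add[of p q]
    by (simp add: lin_ext_superset[of ?A] lookup_add distrib_right sum.distrib)
qed

lemma lin_ext_uminus: "lin_ext h (- p) = - lin_ext h p"
  using lin_ext_add[of h p "- p"] by (simp add: lin_ext_zero minus_unique)

lemma lin_ext_diff: "lin_ext h (p - q) = lin_ext h p - lin_ext h q"
  using lin_ext_add[of h p "- q"] by (simp add: lin_ext_uminus)

lemma lin_ext_sum: "lin_ext h (\<Sum>i\<in>I. p i) = (\<Sum>i\<in>I. lin_ext h (p i))"
  by (induction I rule: infinite_finite_induct) (simp_all add: lin_ext_zero lin_ext_add)

lemma poly_mapping_eq_sum_single: "p = (\<Sum>m\<in>keys p. Poly_Mapping.single m (lookup p m))"
  by (rule poly_mapping_eqI) (auto simp: lookup_sum lookup_single when_def in_keys_iff)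

text \<open>Multiplying by a monomial translates the function \<open>h\<close>. Hence a family of
  functions closed under translation is annihilated by an ideal, which is how the toric ideal is
  handled below.\<close>

lemma lin_ext_mult:
  "lin_ext h (p * q) = (\<Sum>m\<in>keys p. lookup p m * lin_ext (\<lambda>n. h (m + n)) q)"
proof -
  have "p * q = (\<Sum>m\<in>keys p. \<Sum>n\<in>keys q. Poly_Mapping.single (m + n) (lookup p m * lookup q n))"
    using arg_cong2[OF poly_mapping_eq_sum_single[of p] poly_mapping_eq_sum_single[of q], of "(*)"]
    by (simp only: sum_product mult_single)
  then show ?thesis
    by (simp add: lin_ext_sum lin_ext_single lin_ext_def[of _ q] sum_distrib_left mult.assoc)
qed

lemma mpoly_ring_ops:
  "p \<otimes>\<^bsub>mpoly_ring X\<^esub> q = p * q" "p \<oplus>\<^bsub>mpoly_ring X\<^esub> q = p + q" "\<zero>\<^bsub>mpoly_ring X\<^esub> = 0"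
  by (simp_all add: mpoly_ring_def)

lemma mpoly_idealI:
  fixes J :: "('v, 'k::field) mpoly set"
  assumes carr: "J \<subseteq> carrier (mpoly_ring X)" and zero: "0 \<in> J"
    and add: "\<And>p q. p \<in> J \<Longrightarrow> q \<in> J \<Longrightarrow> p + q \<in> J"
    and mult: "\<And>p q. p \<in> carrier (mpoly_ring X) \<Longrightarrow> q \<in> J \<Longrightarrow> p * q \<in> J"
  shows "ideal J (mpoly_ring X)"
proof -
  interpret R: cring "mpoly_ring X :: ('v, 'k) mpoly ring"
    by (rule mpoly_ring_cring)
  have minus: "- p \<in> J" if "p \<in> J" for p
    using mult[of "- 1" p] that by (simp add: mpoly_ring_def)
  show ?thesis
  proof (rule idealI)
    show "subgroup J (add_monoid (mpoly_ring X))"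
    proof (rule R.add.subgroupI)
      fix p assume p: "p \<in> J"
      have "\<ominus>\<^bsub>mpoly_ring X\<^esub> p = - p"
        using p minus[OF p] carr by (intro R.minus_equality) (auto simp: mpoly_ring_def)
      then show "\<ominus>\<^bsub>mpoly_ring X\<^esub> p \<in> J" using minus[OF p] by simp
    qed (use carr zero add in \<open>auto simp: mpoly_ring_def\<close>)
  next
    fix p q :: "('v, 'k) mpoly" assume "p \<in> J" "q \<in> carrier (mpoly_ring X)"
    then show "q \<otimes>\<^bsub>mpoly_ring X\<^esub> p \<in> J" "p \<otimes>\<^bsub>mpoly_ring X\<^esub> q \<in> J"
      using mult[of q p] by (auto simp: mpoly_ring_def mult.commute)
  qed (rule R.ring_axioms)
qed

section \<open>Weights and optimal points of fibres\<close>

lemma weight_superset: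
  assumes "finite A" "keys u \<subseteq> A"
  shows "weight w u = (\<Sum>v\<in>A. w v * real (lookup u v))"
  unfolding weight_def using assms
  by (intro sum.mono_neutral_left) (auto simp: in_keys_iff)

lemma weight_add: "weight w (u + v) = weight w u + weight w v"
proof -
  let ?A = "keys u \<union> keys v"
  show ?thesis
    using keys_add[of u v]
    by (simp add: weight_superset[of ?A] lookup_add distrib_left sum.distrib)
qed

lemma mat_vec_add: "mat_vec E A (u + v) r = mat_vec E A u r + mat_vec E A v r"
  by (simp add: mat_vec_def lookup_add distrib_left sum.distrib)

text \<open>For a generic cost these are the exponents of the standard monomials;
  \<open>xpow_not_in_initial_ideal\<close> and \<open>xpow_in_initial_ideal\<close> supply the two
  directions.\<close>

definition ip_optimal ::
    "'r set \<Rightarrow> 'v set \<Rightarrow> ('r \<Rightarrow> 'v \<Rightarrow> int) \<Rightarrow> ('v \<Rightarrow> real) \<Rightarrow> ('v \<Rightarrow>\<^sub>0 nat) \<Rightarrow> bool" where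
  "ip_optimal R E A w u \<longleftrightarrow> keys u \<subseteq> E \<and>
     (\<forall>v\<in>ip_feasible R E A (mat_vec E A u). weight w u \<le> weight w v)"

lemma ip_optimal_unique:
  assumes gen: "generic_cost R E A w" and u: "ip_optimal R E A w u"
    and v: "v \<in> ip_feasible R E A (mat_vec E A u)" and le: "weight w v \<le> weight w u"
  shows "v = u"
proof -
  let ?F = "ip_feasible R E A (mat_vec E A u)"
  have uF: "u \<in> ?F" using u by (auto simp: ip_optimal_def ip_feasible_def)
  then have "\<exists>!x. x \<in> ?F \<and> (\<forall>y\<in>?F. weight w x \<le> weight w y)"
    using gen unfolding generic_cost_def by blast
  moreover have "\<forall>y\<in>?F. weight w u \<le> weight w y"
    using u by (auto simp: ip_optimal_def)
  moreover then have "\<forall>y\<in>?F. weight w v \<le> weight w y" using le by force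
  ultimately show ?thesis using uF v by blast
qed

text \<open>A cheaper point in the fibre of \<open>u\<close>, translated by \<open>t\<close>, is a
  cheaper point in the fibre of \<open>t + u\<close>. Contrapositively, non-optimal exponents stay
  non-optimal under multiplication, as membership in an ideal demands.\<close>

lemma ip_optimal_addD:
  assumes "ip_optimal R E A w (t + u)" "keys u \<subseteq> E" "keys t \<subseteq> E"
  shows "ip_optimal R E A w u"
  unfolding ip_optimal_def
proof safe
  fix v assume v: "v \<in> ip_feasible R E A (mat_vec E A u)"
  then have "t + v \<in> ip_feasible R E A (mat_vec E A (t + u))"
    using assms(3) keys_add[of t v] by (auto simp: ip_feasible_def mat_vec_add)
  then show "weight w u \<le> weight w v"
    using assms(1) by (fastforce simp: ip_optimal_def weight_add)
qed (use assms in auto)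

text \<open>For \<open>h\<close> the indicator of a fibre, \<open>lin_ext h p\<close> is the sum of the coefficients of \<open>p\<close> over it.\<close>

lemma toric_ideal_lin_ext_zero:
  fixes h :: "('v \<Rightarrow>\<^sub>0 nat) \<Rightarrow> 'k::field"
  assumes "p \<in> toric_ideal R E A"
    and "\<And>u v. keys v \<subseteq> E \<Longrightarrow> u \<in> ip_feasible R E A (mat_vec E A v) \<Longrightarrow> h u = h v"
  shows "p \<in> carrier (mpoly_ring E) \<and> lin_ext h p = 0"
proof -
  define invariant where "invariant h \<longleftrightarrow>
    (\<forall>u v. keys v \<subseteq> E \<longrightarrow> u \<in> ip_feasible R E A (mat_vec E A v) \<longrightarrow> h u = h v)"
    for h :: "('v \<Rightarrow>\<^sub>0 nat) \<Rightarrow> 'k"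
  \<comment> \<open>All fibre-invariant functions are imposed at once, since closure under products
    replaces \<open>h\<close> by its translates.\<close>
  define K where "K = {p \<in> carrier (mpoly_ring E). \<forall>h. invariant h \<longrightarrow> lin_ext h p = 0}"
  interpret R: cring "mpoly_ring E :: ('v, 'k) mpoly ring"
    by (rule mpoly_ring_cring)
  have "ideal K (mpoly_ring E)"
  proof (rule mpoly_idealI)
    fix p q assume "p \<in> K" "q \<in> K"
    then show "p + q \<in> K"
      using R.add.m_closed[of p q] by (simp add: K_def lin_ext_add mpoly_ring_ops)
  next
    fix p q :: "('v, 'k) mpoly" assume p: "p \<in> carrier (mpoly_ring E)" and q: "q \<in> K"
    have "lin_ext h (p * q) = 0" if h: "invariant h" for h
    proof -
      have "lin_ext (\<lambda>n. h (m + n)) q = 0" if "m \<in> keys p" for m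
      proof -
        have m: "keys m \<subseteq> E" using p that by (auto simp: mpoly_ring_def)
        have "invariant (\<lambda>n. h (m + n))"
          unfolding invariant_def
        proof (intro allI impI)
          fix u v assume "keys v \<subseteq> E" "u \<in> ip_feasible R E A (mat_vec E A v)"
          then have "keys (m + v) \<subseteq> E" "m + u \<in> ip_feasible R E A (mat_vec E A (m + v))"
            using m keys_add[of m u] keys_add[of m v] by (auto simp: ip_feasible_def mat_vec_add)
          then show "h (m + u) = h (m + v)" using h by (auto simp: invariant_def)
        qed
        then show ?thesis using q by (auto simp: K_def)
      qed
      then show ?thesis by (simp add: lin_ext_mult)
    qed
    then show "p * q \<in> K"
      using R.m_closed[of p q] p q by (simp add: K_def mpoly_ring_ops)
  qed (auto simp: K_def lin_ext_zero mpoly_ring_def)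
  moreover have "{xpow u - xpow v | u v. keys u \<subseteq> E \<and> keys v \<subseteq> E \<and>
      (\<forall>r\<in>R. mat_vec E A u r = mat_vec E A v r)} \<subseteq> K"
  proof clarify
    fix u v assume uv: "keys u \<subseteq> E" "keys v \<subseteq> E" "\<forall>r\<in>R. mat_vec E A u r = mat_vec E A v r"
    have "(xpow u - xpow v :: ('v, 'k) mpoly) \<in> carrier (mpoly_ring E)"
      using uv keys_diff[of "xpow u :: ('v, 'k) mpoly" "xpow v"]
      by (auto simp: mpoly_ring_def xpow_def)
    moreover have "lin_ext h (xpow u - xpow v) = 0" if "invariant h" for h
    proof -
      have "u \<in> ip_feasible R E A (mat_vec E A v)" using uv by (simp add: ip_feasible_def)
      then have "h u = h v" using that uv(2) unfolding invariant_def by blast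
      then show ?thesis by (simp add: lin_ext_diff lin_ext_single xpow_def)
    qed
    ultimately show "(xpow u - xpow v :: ('v, 'k) mpoly) \<in> K"
      by (simp add: K_def)
  qed
  ultimately have "toric_ideal R E A \<subseteq> K"
    unfolding toric_ideal_def by (rule R.genideal_minimal)
  moreover have "invariant h" using assms(2) unfolding invariant_def by blast
  ultimately show ?thesis using assms(1) by (auto simp: K_def)
qed

section \<open>Initial forms and standard monomials\<close>

lemma lookup_initial_form:
  "lookup (initial_form w f) m =
    (if m \<in> keys f \<and> weight w m = Max (weight w ` keys f) then lookup f m else 0)"
  unfolding initial_form_def by (auto simp: lookup_sum lookup_single when_def)

lemma keys_initial_form:
  "keys (initial_form w f) = {m \<in> keys f. weight w m = Max (weight w ` keys f)}"
  by (auto simp: in_keys_iff lookup_initial_form split: if_splits)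

lemma initial_form_in_carrier:
  "f \<in> carrier (mpoly_ring X) \<Longrightarrow> initial_form w f \<in> carrier (mpoly_ring X)"
  by (auto simp: mpoly_ring_def keys_initial_form)

lemma toric_ideal_carrier:
  "(toric_ideal R E A :: ('v, 'k::field) mpoly set) \<subseteq> carrier (mpoly_ring E)"
  using toric_ideal_lin_ext_zero[where h = "\<lambda>_. 0"] by blast

text \<open>The coefficients of \<open>f\<close> over the fibre of \<open>m\<close> sum to zero, so
  \<open>f\<close> has another exponent \<open>n\<close> in that fibre. As \<open>m\<close> has
  maximal weight in \<open>f\<close>, \<open>n\<close> is no heavier, which contradicts uniqueness
  of the optimum.\<close>

lemma keys_initial_form_not_optimal:
  fixes f :: "('v, 'k::field) mpoly"
  assumes gen: "generic_cost R E A w" and f: "f \<in> toric_ideal R E A"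
    and m: "m \<in> keys (initial_form w f)"
  shows "\<not> ip_optimal R E A w m"
proof
  assume opt: "ip_optimal R E A w m"
  have mf: "m \<in> keys f" and max: "weight w m = Max (weight w ` keys f)"
    using m by (auto simp: keys_initial_form)
  define F where "F = ip_feasible R E A (mat_vec E A m)"
  define h :: "('v \<Rightarrow>\<^sub>0 nat) \<Rightarrow> 'k" where "h u = (if u \<in> F then 1 else 0)" for u
  have mF: "m \<in> F" using opt by (auto simp: F_def ip_optimal_def ip_feasible_def)
  have "lin_ext h f = 0"
    by (rule conjunct2[OF toric_ideal_lin_ext_zero[OF f]]) (auto simp: h_def F_def ip_feasible_def)
  then have "(\<Sum>n\<in>keys f. lookup f n * h n) = 0" by (simp add: lin_ext_def)
  then have "lookup f m * h m + (\<Sum>n\<in>keys f - {m}. lookup f n * h n) = 0"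
    using mf by (simp add: sum.remove)
  then have "(\<Sum>n\<in>keys f - {m}. lookup f n * h n) \<noteq> 0"
    using mf mF by (auto simp: h_def in_keys_iff)
  then obtain n where n: "n \<in> keys f" "n \<noteq> m" "h n \<noteq> 0"
    by (metis (no_types, lifting) DiffE insertCI mult_zero_right sum.neutral)
  then have "n \<in> F" by (auto simp: h_def split: if_splits)
  moreover have "weight w n \<le> weight w m" using n(1) by (simp add: max)
  ultimately show False using ip_optimal_unique[OF gen opt] n(2) by (auto simp: F_def)
qed

text \<open>The polynomials all of whose exponents are non-optimal form an ideal containing every
  initial form, hence the whole initial ideal.\<close>

lemma xpow_not_in_initial_ideal:
  assumes gen: "generic_cost R E A w" and u: "ip_optimal R E A w u"
  shows "(xpow u :: ('v, 'k::field) mpoly) \<notin> initial_ideal E w (toric_ideal R E A)"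
proof -
  define N where "N = {p \<in> carrier (mpoly_ring E) :: ('v, 'k) mpoly set.
    \<forall>m\<in>keys p. \<not> ip_optimal R E A w m}"
  interpret R: cring "mpoly_ring E :: ('v, 'k) mpoly ring"
    by (rule mpoly_ring_cring)
  have "ideal N (mpoly_ring E)"
  proof (rule mpoly_idealI)
    fix p q assume "p \<in> N" "q \<in> N"
    then show "p + q \<in> N"
      using R.add.m_closed[of p q] keys_add[of p q] by (auto simp: N_def mpoly_ring_ops)
  next
    fix p q :: "('v, 'k) mpoly" assume p: "p \<in> carrier (mpoly_ring E)" and q: "q \<in> N"
    have "\<not> ip_optimal R E A w m" if m: "m \<in> keys (p * q)" for m
    proof -
      obtain s t where "s \<in> keys p" "t \<in> keys q" "m = s + t"
        using m keys_mult[of p q] by blast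
      then show ?thesis
        using p q ip_optimal_addD[of R E A w s t] by (auto simp: N_def mpoly_ring_def)
    qed
    then show "p * q \<in> N"
      using R.m_closed[of p q] p q by (simp add: N_def mpoly_ring_ops)
  qed (auto simp: N_def mpoly_ring_def)
  moreover have "initial_form w ` toric_ideal R E A \<subseteq> N"
    unfolding N_def using initial_form_in_carrier toric_ideal_carrier[of R E A]
      keys_initial_form_not_optimal[OF gen] by blast
  ultimately have "initial_ideal E w (toric_ideal R E A) \<subseteq> N"
    unfolding initial_ideal_def by (rule R.genideal_minimal)
  moreover have "(xpow u :: ('v, 'k) mpoly) \<notin> N" using u by (auto simp: N_def xpow_def)
  ultimately show ?thesis by blast
qed

lemma lookup_xpow: "lookup (xpow u) m = (if m = u then 1 else 0)"
  by (auto simp: xpow_def lookup_single when_def)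

text \<open>The binomial \<open>xpow u - xpow v\<close> lies in the toric ideal, and its initial
  form is the heavier monomial \<open>xpow u\<close>.\<close>

lemma xpow_in_initial_ideal:
  assumes u: "keys u \<subseteq> E" and v: "v \<in> ip_feasible R E A (mat_vec E A u)"
    and less: "weight w v < weight w u"
  shows "(xpow u :: ('v, 'k::field) mpoly) \<in> initial_ideal E w (toric_ideal R E A)"
proof -
  interpret R: cring "mpoly_ring E :: ('v, 'k) mpoly ring"
    by (rule mpoly_ring_cring)
  let ?f = "xpow u - xpow v :: ('v, 'k) mpoly"
  have ne: "u \<noteq> v" using less by auto
  have "lookup ?f m = (if m = u then 1 else if m = v then - 1 else 0)" for m
    using ne by (simp add: lookup_minus lookup_xpow)
  then have keys_f: "keys ?f = {u, v}" and f_u: "lookup ?f u = 1"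
    by (auto simp: in_keys_iff split: if_splits)
  have "initial_form w ?f = xpow u"
    by (rule poly_mapping_eqI)
      (use less f_u in \<open>auto simp: lookup_initial_form keys_f lookup_xpow\<close>)
  moreover have "?f \<in> toric_ideal R E A"
  proof -
    let ?G = "{xpow u - xpow v | u v. keys u \<subseteq> E \<and> keys v \<subseteq> E \<and>
      (\<forall>r\<in>R. mat_vec E A u r = mat_vec E A v r)} :: ('v, 'k) mpoly set"
    have "?f \<in> ?G" using u v by (fastforce simp: ip_feasible_def)
    moreover have "?G \<subseteq> Idl\<^bsub>mpoly_ring E\<^esub> ?G"
      unfolding genideal_def by blast
    ultimately show ?thesis unfolding toric_ideal_def by blast
  qed
  ultimately have "xpow u \<in> initial_form w ` (toric_ideal R E A :: ('v, 'k) mpoly set)"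
    by force
  then show ?thesis unfolding initial_ideal_def genideal_def by blast
qed

section \<open>Tensions and flows of the tournament\<close>

lemma finite_arcs [simp]: "finite (arcs d)"
  by (rule finite_subset[of _ "{1..d} \<times> {1..d}"]) (auto simp: arcs_def)

lemma path_tree_subset_arcs: "path_tree d \<subseteq> arcs d"
  by (auto simp: path_tree_def arcs_def)

lemma finite_path_tree [simp]: "finite (path_tree d)"
  using path_tree_subset_arcs finite_arcs by (rule finite_subset)

lemma path_tree_eq_image: "path_tree d = (\<lambda>k. (k, k + 1)) ` {1..<d}"
  by (auto simp: path_tree_def)

lemma mat_vec_circuit_mat:
  assumes g: "g \<in> arcs d - path_tree d"
  shows "mat_vec (arcs d) (circuit_mat d) u g =
    int (lookup u g) - (\<Sum>e\<in>path_tree d. M d e g * int (lookup u e))"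
proof -
  have "mat_vec (arcs d) (circuit_mat d) u g =
      (\<Sum>e\<in>arcs d - path_tree d. circuit_mat d g e * int (lookup u e)) +
      (\<Sum>e\<in>path_tree d. circuit_mat d g e * int (lookup u e))"
    unfolding mat_vec_def by (rule sum.subset_diff) (auto simp: path_tree_subset_arcs)
  also have "(\<Sum>e\<in>path_tree d. circuit_mat d g e * int (lookup u e)) =
      - (\<Sum>e\<in>path_tree d. M d e g * int (lookup u e))"
    by (simp add: circuit_mat_def sum_negf)
  also have "(\<Sum>e\<in>arcs d - path_tree d. circuit_mat d g e * int (lookup u e)) =
      (\<Sum>e\<in>arcs d - path_tree d. if e = g then int (lookup u e) else 0)"
    by (rule sum.cong) (auto simp: circuit_mat_def)
  finally show ?thesis using g by simp
qed

abbreviation dual_fiber :: "nat \<Rightarrow> (arc \<Rightarrow>\<^sub>0 nat) \<Rightarrow> (arc \<Rightarrow>\<^sub>0 nat) set" where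
  "dual_fiber d u \<equiv> ip_feasible (arcs d - path_tree d) (arcs d) (circuit_mat d)
     (mat_vec (arcs d) (circuit_mat d) u)"

definition feasible_flow :: "nat \<Rightarrow> (arc \<Rightarrow> real) \<Rightarrow> (arc \<Rightarrow> real) \<Rightarrow> bool" where
  "feasible_flow d b x \<longleftrightarrow> (\<forall>f\<in>arcs d. 0 \<le> x f) \<and>
     (\<forall>e\<in>path_tree d. (\<Sum>f\<in>arcs d. of_int (cutset_mat d e f) * x f) = b e)"

text \<open>Linear programming duality: a feasible flow replaces the cost \<open>b\<close> by a non-negative one.\<close>

lemma weight_diff_eq_flow:
  assumes cost: "dual_cost d b" and x: "feasible_flow d b x"
    and u: "keys u \<subseteq> arcs d" and v: "v \<in> dual_fiber d u"
  shows "weight b v - weight b u = (\<Sum>f\<in>arcs d. x f * (real (lookup v f) - real (lookup u f)))"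
proof -
  define \<delta> where "\<delta> f = real (lookup v f) - real (lookup u f)" for f
  have vE: "keys v \<subseteq> arcs d" using v by (simp add: ip_feasible_def)
  \<comment> \<open>The difference \<open>\<delta>\<close> of two points of a fibre is in the kernel
    of \<open>(I -M\<^sup>T)\<close>. It is therefore recovered from its entries on the path by the
    transpose of \<open>(M I)\<close>.\<close>
  have tension: "(\<Sum>e\<in>path_tree d. of_int (cutset_mat d e f) * \<delta> e) = \<delta> f" if f: "f \<in> arcs d" for f
  proof (cases "f \<in> path_tree d")
    case True
    then have "(\<Sum>e\<in>path_tree d. of_int (cutset_mat d e f) * \<delta> e) =
        (\<Sum>e\<in>path_tree d. if e = f then \<delta> e else 0)"
      by (intro sum.cong) (auto simp: cutset_mat_def)
    then show ?thesis using True by simp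
  next
    case False
    then have "int (lookup v f) - (\<Sum>e\<in>path_tree d. M d e f * int (lookup v e)) =
        int (lookup u f) - (\<Sum>e\<in>path_tree d. M d e f * int (lookup u e))"
      using v f by (simp add: ip_feasible_def mat_vec_circuit_mat)
    then have "int (lookup v f) - int (lookup u f) =
        (\<Sum>e\<in>path_tree d. M d e f * (int (lookup v e) - int (lookup u e)))"
      by (simp add: right_diff_distrib sum_subtractf)
    then have "of_int (int (lookup v f) - int (lookup u f)) =
        (of_int (\<Sum>e\<in>path_tree d. M d e f * (int (lookup v e) - int (lookup u e))) :: real)"
      by (rule arg_cong)
    then show ?thesis using False by (simp add: \<delta>_def cutset_mat_def)
  qed
  have "weight b v - weight b u = (\<Sum>f\<in>arcs d. b f * \<delta> f)"
    using u vE by (simp add: weight_superset[of "arcs d"] \<delta>_def right_diff_distrib sum_subtractf)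
  also have "\<dots> = (\<Sum>e\<in>path_tree d. b e * \<delta> e)"
    using cost path_tree_subset_arcs by (intro sum.mono_neutral_right) (auto simp: dual_cost_def)
  also have "\<dots> = (\<Sum>e\<in>path_tree d. (\<Sum>f\<in>arcs d. of_int (cutset_mat d e f) * x f) * \<delta> e)"
    using x by (simp add: feasible_flow_def)
  also have "\<dots> = (\<Sum>f\<in>arcs d. x f * (\<Sum>e\<in>path_tree d. of_int (cutset_mat d e f) * \<delta> e))"
    by (simp add: sum_distrib_left sum_distrib_right mult_ac, rule sum.swap)
  also have "\<dots> = (\<Sum>f\<in>arcs d. x f * \<delta> f)" by (simp add: tension)
  finally show ?thesis by (simp add: \<delta>_def)
qed

text \<open>Complementary slackness: on the support of \<open>u\<close> the flow vanishes, and
  elsewhere \<open>v\<close> can only exceed \<open>u\<close>, so every summand of the weight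
  difference is non-negative.\<close>

lemma ip_optimal_if_flow:
  assumes cost: "dual_cost d b" and x: "feasible_flow d b x"
    and u: "keys u \<subseteq> arcs d" and supp: "\<forall>f\<in>keys u. x f = 0"
  shows "ip_optimal (arcs d - path_tree d) (arcs d) (circuit_mat d) b u"
  unfolding ip_optimal_def
proof (intro conjI ballI u)
  fix v assume v: "v \<in> dual_fiber d u"
  have "0 \<le> x f * (real (lookup v f) - real (lookup u f))" if "f \<in> arcs d" for f
    using that x supp by (cases "f \<in> keys u") (auto simp: feasible_flow_def in_keys_iff)
  then have "0 \<le> weight b v - weight b u"
    unfolding weight_diff_eq_flow[OF cost x u v] by (rule sum_nonneg)
  then show "weight b u \<le> weight b v" by simp
qed

text \<open>Passing to \<open>- D\<close> gives the arcs entering \<open>D\<close>, so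
  \<open>cut_vec d D\<close> and \<open>cut_vec d (- D)\<close> are the positive and negative parts
  of one cutset.\<close>

definition cut_vec :: "nat \<Rightarrow> nat set \<Rightarrow> arc \<Rightarrow>\<^sub>0 nat" where
  "cut_vec d D = (\<Sum>e\<in>{e \<in> arcs d. fst e \<in> D \<and> snd e \<notin> D}. Poly_Mapping.single e 1)"

lemma lookup_cut_vec:
  "lookup (cut_vec d D) e = (if e \<in> arcs d \<and> fst e \<in> D \<and> snd e \<notin> D then 1 else 0)"
  by (simp add: cut_vec_def lookup_sum lookup_single when_def)

lemma keys_cut_vec: "keys (cut_vec d D) = {e \<in> arcs d. fst e \<in> D \<and> snd e \<notin> D}"
  by (auto simp: in_keys_iff lookup_cut_vec split: if_splits)

text \<open>The difference of the two vectors is the tension of the potential \<open>p\<close>, the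
  indicator of the complement of \<open>D\<close>. Along the path from \<open>i\<close> to
  \<open>j\<close> it telescopes to its value on \<open>(i, j)\<close>, which is the row equation of
  the circuit matrix.\<close>

lemma cut_vec_fiber: "cut_vec d (- D) \<in> dual_fiber d (cut_vec d D)"
proof -
  define \<delta> where "\<delta> e = int (lookup (cut_vec d D) e) - int (lookup (cut_vec d (- D)) e)" for e
  define p :: "nat \<Rightarrow> int" where "p i = (if i \<in> D then 0 else 1)" for i
  have \<delta>: "\<delta> (i, j) = p j - p i" if "(i, j) \<in> arcs d" for i j
    using that by (simp add: \<delta>_def p_def lookup_cut_vec)
  have "mat_vec (arcs d) (circuit_mat d) (cut_vec d (- D)) g =
      mat_vec (arcs d) (circuit_mat d) (cut_vec d D) g" if g: "g \<in> arcs d - path_tree d" for g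
  proof -
    obtain i j where ij: "g = (i, j)" "1 \<le> i" "i < j" "j \<le> d"
      using g by (auto simp: arcs_def)
    have "(\<Sum>e\<in>path_tree d. M d e g * \<delta> e) = (\<Sum>k\<in>{1..<d}. M d (k, k + 1) g * \<delta> (k, k + 1))"
      unfolding path_tree_eq_image by (subst sum.reindex) (auto simp: inj_on_def)
    also have "\<dots> = (\<Sum>k\<in>{i..<j}. p (Suc k) - p k)"
    proof (rule sum.mono_neutral_cong_right)
      fix k assume "k \<in> {i..<j}"
      then show "M d (k, k + 1) g * \<delta> (k, k + 1) = p (Suc k) - p k"
        using M_path_tree[of k d i j] \<delta>[of k "k + 1"] ij g by (auto simp: arcs_def)
    next
      show "\<forall>k\<in>{1..<d} - {i..<j}. M d (k, k + 1) g * \<delta> (k, k + 1) = 0"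
        using M_path_tree[of _ d i j] ij g by auto
    qed (use ij in auto)
    also have "\<dots> = p j - p i" using ij by (intro sum_Suc_diff') simp
    also have "\<dots> = \<delta> g" using \<delta>[of i j] g ij by simp
    finally show ?thesis
      by (simp add: mat_vec_circuit_mat[OF g] \<delta>_def right_diff_distrib sum_subtractf)
  qed
  then show ?thesis by (auto simp: ip_feasible_def keys_cut_vec)
qed

section \<open>Trees given by their fundamental cuts\<close>

text \<open>An explicit certificate for the two sides of a fundamental cutset, which avoids
  computing components of \<open>T - {e}\<close>. The set \<open>D\<close> may contain numbers that
  are not vertices.\<close>

definition isolating_cut :: "arc set \<Rightarrow> arc \<Rightarrow> nat set \<Rightarrow> bool" where
  "isolating_cut T e D \<longleftrightarrow> fst e \<in> D \<and> snd e \<notin> D \<and>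
     (\<forall>f\<in>T. f \<noteq> e \<longrightarrow> (fst f \<in> D \<longleftrightarrow> snd f \<in> D))"

text \<open>A cycle through \<open>e\<close> would have to cross its isolating cut a second time,
  but no other arc of \<open>T\<close> crosses it. Connectedness reduces to consecutive vertices by
  chaining.\<close>

lemma spanning_tree_if_cuts:
  assumes T: "T \<subseteq> arcs d" and cuts: "\<And>e. e \<in> T \<Longrightarrow> \<exists>D. isolating_cut T e D"
    and conn: "\<And>k. 1 \<le> k \<Longrightarrow> k < d \<Longrightarrow> (k, k + 1) \<in> (T \<union> T\<inverse>)\<^sup>*"
  shows "spanning_tree d T"
  unfolding spanning_tree_def
proof (intro conjI ballI notI T)
  fix u v assume uv: "u \<in> {1..d}" "v \<in> {1..d}"
  have sym: "sym ((T \<union> T\<inverse>)\<^sup>*)" by (intro sym_rtrancl sym_Un_converse)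
  have from_1: "(1, k) \<in> (T \<union> T\<inverse>)\<^sup>*" if "1 \<le> k" "k \<le> d" for k
    using that
  proof (induction k rule: dec_induct)
    case (step k)
    then show ?case using conn[of k] by (auto intro: rtrancl_trans)
  qed simp
  show "(u, v) \<in> (T \<union> T\<inverse>)\<^sup>*"
    using uv from_1[of u] from_1[of v] sym by (auto dest: symD intro: rtrancl_trans)
next
  assume "\<exists>vs. is_cycle T vs"
  then obtain vs where n: "length vs \<ge> 3" and dist: "distinct vs"
    and cyc: "\<And>i. i < length vs \<Longrightarrow> (vs ! i, vs ! (Suc i mod length vs)) \<in> T \<union> T\<inverse>"
    by (auto simp: is_cycle_def)
  have "0 < length vs" "Suc 0 mod length vs = 1" using n by auto
  then have "(vs ! 0, vs ! 1) \<in> T \<union> T\<inverse>" using cyc[of 0] by simp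
  then obtain e where e: "e \<in> T" "e = (vs ! 0, vs ! 1) \<or> e = (vs ! 1, vs ! 0)" by auto
  obtain D where D: "isolating_cut T e D" using cuts[OF e(1)] by blast
  have same_side: "vs ! i \<in> D \<longleftrightarrow> vs ! (Suc i mod length vs) \<in> D" if i: "1 \<le> i" "i < length vs" for i
  proof -
    define j where "j = Suc i mod length vs"
    \<comment> \<open>Because the cycle has at least three vertices, the remaining steps never
      traverse \<open>e\<close>; in particular the step from \<open>vs ! 1\<close> does not return
      to \<open>vs ! 0\<close>.\<close>
    have j: "j < length vs" "j \<noteq> 1" "i = 1 \<Longrightarrow> j \<noteq> 0"
      using i n by (cases "Suc i = length vs"; auto simp: j_def)+
    have "vs ! p = vs ! q \<longleftrightarrow> p = q" if "p < length vs" "q < length vs" for p q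
      using nth_eq_iff_index_eq[OF dist that] .
    then have "(vs ! i, vs ! j) \<noteq> e" "(vs ! j, vs ! i) \<noteq> e"
      using e(2) i j n \<open>0 < length vs\<close> by fastforce+
    then show ?thesis using D cyc[OF i(2)] unfolding isolating_cut_def j_def by fastforce
  qed
  have "vs ! 1 \<in> D \<longleftrightarrow> vs ! i \<in> D" if "1 \<le> i" "i < length vs" for i
    using that
  proof (induction i rule: dec_induct)
    case (step k)
    then show ?case using same_side[of k] by simp
  qed simp
  then have "vs ! 1 \<in> D \<longleftrightarrow> vs ! (length vs - 1) \<in> D" using n by force
  also have "\<dots> \<longleftrightarrow> vs ! 0 \<in> D"
  proof -
    have "Suc (length vs - 1) = length vs" using n by linarith
    then show ?thesis using same_side[of "length vs - 1"] n by simp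
  qed
  finally show False using D e(2) by (auto simp: isolating_cut_def)
qed

text \<open>Genericity makes the flow positive on \<open>T\<close>: an arc without flow would yield a fundamental
  cutset with both sides optimal. Hence every fundamental cutset reduces its positive side, which
  is the maximality of the pair.\<close>

lemma standard_pair_if_flow:
  fixes b :: "arc \<Rightarrow> real"
  assumes cost: "dual_cost d b" and gen: "dual_generic d b"
    and x: "feasible_flow d b x" and T: "T \<subseteq> arcs d"
    and supp: "\<And>f. f \<in> arcs d - T \<Longrightarrow> x f = 0"
    and cuts: "\<And>e. e \<in> T \<Longrightarrow> \<exists>D. isolating_cut T e D"
  shows "((1, arcs d - T) :: (arc, 'k::field) mpoly \<times> arc set) \<in> dual_standard_pairs d b"
proof -
  let ?J = "initial_ideal (arcs d) b (dual_toric_ideal d :: (arc, 'k) mpoly set)"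
  let ?opt = "ip_optimal (arcs d - path_tree d) (arcs d) (circuit_mat d) b"
  have opt: "?opt u" if "keys u \<subseteq> arcs d - T" for u
    using that supp by (intro ip_optimal_if_flow[OF cost x]) auto
  have adm: "admissible_pair (arcs d) ?J 0 (arcs d - T)"
    using xpow_not_in_initial_ideal[OF gen[unfolded dual_generic_def] opt]
    by (auto simp: admissible_pair_def pair_monomials_def dual_toric_ideal_def)
  have reducible: "\<exists>u. keys u \<subseteq> insert e (arcs d - T) \<and> (xpow u :: (arc, 'k) mpoly) \<in> ?J"
    if e: "e \<in> T" for e
  proof -
    obtain D where D: "isolating_cut T e D" using cuts[OF e] by blast
    let ?u = "cut_vec d D" and ?v = "cut_vec d (- D)"
    have u: "keys ?u \<subseteq> insert e (arcs d - T)" and v: "keys ?v \<subseteq> arcs d - T"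
      using D unfolding isolating_cut_def keys_cut_vec by auto
    have uv: "?v \<in> dual_fiber d ?u" and vu: "?u \<in> dual_fiber d ?v"
      using cut_vec_fiber[of d D] cut_vec_fiber[of d "- D"] by simp_all
    have "?u \<noteq> ?v"
    proof
      assume "?u = ?v"
      then have "lookup ?u e = lookup ?v e" by simp
      then show False using D e T by (auto simp: lookup_cut_vec isolating_cut_def)
    qed
    \<comment> \<open>The negative side \<open>?v\<close> avoids \<open>T\<close> and is thus
      optimal; if \<open>?u\<close> were no heavier, uniqueness would identify the two.\<close>
    then have "weight b ?v < weight b ?u"
      using ip_optimal_unique[OF gen[unfolded dual_generic_def] opt[OF v] vu] by fastforce
    then have "(xpow ?u :: (arc, 'k) mpoly) \<in> ?J"
      unfolding dual_toric_ideal_def using uv by (intro xpow_in_initial_ideal) (auto simp: keys_cut_vec)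
    then show ?thesis using u by blast
  qed
  \<comment> \<open>Maximality: the monomial 1 forces \<open>a = 0\<close>, the single variables
    force \<open>\<tau>\<close> to contain the co-tree, and any further arc of \<open>T\<close> in
    \<open>\<tau>\<close> would bring in a reducible monomial.\<close>
  have "a = 0 \<and> \<tau> = arcs d - T"
    if a: "admissible_pair (arcs d) ?J a \<tau>"
      and sub: "(pair_monomials 0 (arcs d - T) :: (arc, 'k) mpoly set) \<subseteq> pair_monomials a \<tau>" for a \<tau>
  proof -
    have factor: "\<exists>c. u = a + c \<and> keys c \<subseteq> \<tau>" if "keys u \<subseteq> arcs d - T" for u
    proof -
      have "(xpow u :: (arc, 'k) mpoly) \<in> pair_monomials 0 (arcs d - T)"
        using that by (auto simp: pair_monomials_def)
      then have "(xpow u :: (arc, 'k) mpoly) \<in> pair_monomials a \<tau>" using sub by blast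
      then obtain c where c: "(xpow u :: (arc, 'k) mpoly) = xpow (a + c)" "keys c \<subseteq> \<tau>"
        by (auto simp: pair_monomials_def)
      have "u = a + c"
        using arg_cong[OF c(1), of keys] by (simp add: xpow_def)
      then show ?thesis using c by blast
    qed
    obtain c where c: "0 = a + c" using factor[of 0] by auto
    have a0: "a = 0"
      by (rule poly_mapping_eqI) (use arg_cong[OF c, of lookup] in \<open>auto simp: lookup_add fun_eq_iff\<close>)
    have "f \<in> \<tau>" if f: "f \<in> arcs d - T" for f
      using factor[of "Poly_Mapping.single f 1"] f a0 by auto
    moreover have "e \<notin> T" if e: "e \<in> \<tau>" for e
    proof
      assume "e \<in> T"
      then obtain u where u: "keys u \<subseteq> insert e (arcs d - T)" "(xpow u :: (arc, 'k) mpoly) \<in> ?J"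
        using reducible by blast
      then have "keys u \<subseteq> \<tau>" using e calculation by blast
      then have "(xpow u :: (arc, 'k) mpoly) \<in> pair_monomials a \<tau>"
        using a0 by (auto simp: pair_monomials_def)
      then show False using a u(2) by (auto simp: admissible_pair_def)
    qed
    ultimately show ?thesis using a a0 by (auto simp: admissible_pair_def)
  qed
  moreover have "(1 :: (arc, 'k) mpoly) = xpow 0" by (simp add: xpow_def)
  ultimately show ?thesis
    unfolding dual_standard_pairs_def standard_pairs_def using adm by blast
qed

section \<open>Flipping cuts in disjoint pairs\<close>

text \<open>Cut \<open>k\<close> separates \<open>{1..k}\<close> from the rest. The cuts \<open>2m + 1\<close> and \<open>2m + 2\<close> form a block.\<close>

definition partner :: "nat \<Rightarrow> nat" where
  "partner k = (if odd k then k + 1 else k - 1)"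

text \<open>The bound \<open>partner k < d\<close>, together with \<open>k < d\<close>, places the
  arc of length two over the block of \<open>k\<close> inside the graph. The cost inequality keeps
  the flow left on the partner's path arc non-negative.\<close>

definition flippable :: "nat \<Rightarrow> (arc \<Rightarrow> real) \<Rightarrow> nat set \<Rightarrow> bool" where
  "flippable d b \<sigma> \<longleftrightarrow> (\<forall>k\<in>\<sigma>. 1 \<le> k \<and> k < d \<and> partner k < d \<and> partner k \<notin> \<sigma> \<and>
     b (k, k + 1) \<le> b (partner k, partner k + 1))"

definition flip_tree :: "nat \<Rightarrow> nat set \<Rightarrow> arc set" where
  "flip_tree d \<sigma> = {(k, k + 1) | k. 1 \<le> k \<and> k < d \<and> k \<notin> \<sigma>} \<union>
     {(l, l + 2) | l. odd l \<and> l + 2 \<le> d \<and> (l \<in> \<sigma> \<or> l + 1 \<in> \<sigma>)}"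

text \<open>The amount rerouted over the long arc of the block of \<open>k\<close>; for flippable
  \<open>\<sigma>\<close> both cuts of a complete block give the same value.\<close>

definition long_flow :: "(arc \<Rightarrow> real) \<Rightarrow> nat set \<Rightarrow> nat \<Rightarrow> real" where
  "long_flow b \<sigma> k = (if k \<in> \<sigma> then b (k, k + 1)
     else if partner k \<in> \<sigma> then b (partner k, partner k + 1) else 0)"

definition flip_flow :: "(arc \<Rightarrow> real) \<Rightarrow> nat set \<Rightarrow> arc \<Rightarrow> real" where
  "flip_flow b \<sigma> = (\<lambda>(i, j). if j = i + 1 then b (i, i + 1) - long_flow b \<sigma> i
     else if odd i \<and> j = i + 2 then long_flow b \<sigma> i else 0)"

lemma partner_partner: "1 \<le> k \<Longrightarrow> partner (partner k) = k"
  by (auto simp: partner_def)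

text \<open>The identity columns fit the same formula as \<open>M\<close>, so \<open>(M I)\<close>
  is an interval matrix: the arc \<open>(i, j)\<close> crosses precisely the cuts from
  \<open>i\<close> to \<open>j - 1\<close>.\<close>

lemma cutset_mat_eq:
  assumes "1 \<le> k" "k < d" "(i, j) \<in> arcs d"
  shows "cutset_mat d (k, k + 1) (i, j) = (if i \<le> k \<and> k < j then 1 else 0)"
  using M_path_tree[OF assms] assms(3) by (auto simp: cutset_mat_def path_tree_def arcs_def)

lemma dual_cost_nonneg:
  assumes "nonneg_solvable d b" "1 \<le> k" "k < d"
  shows "0 \<le> b (k, k + 1)"
proof -
  obtain x where x: "\<forall>f\<in>arcs d. 0 \<le> x f"
      "\<forall>e\<in>path_tree d. (\<Sum>f\<in>arcs d. of_int (cutset_mat d e f) * x f) = b e"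
    using assms(1) by (auto simp: nonneg_solvable_def)
  have "0 \<le> (\<Sum>f\<in>arcs d. of_int (cutset_mat d (k, k + 1) f) * x f)"
  proof (rule sum_nonneg)
    fix f assume f: "f \<in> arcs d"
    then show "0 \<le> of_int (cutset_mat d (k, k + 1) f) * x f"
      using cutset_mat_eq[OF assms(2,3), of "fst f" "snd f"] x(1) by simp
  qed
  then show ?thesis using x(2) assms(2,3) by (auto simp: path_tree_def)
qed

text \<open>Across a cut, only its own path arc and the long arc of its block can carry flow. What
  the long arc gains, the path arc loses, so the total remains \<open>b e\<close>.\<close>

lemma flip_flow_feasible:
  assumes nonneg: "nonneg_solvable d b" and \<sigma>: "flippable d b \<sigma>"
  shows "feasible_flow d b (flip_flow b \<sigma>)"
  unfolding feasible_flow_def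
proof (intro conjI ballI)
  fix f assume f: "f \<in> arcs d"
  obtain i j where ij: "f = (i, j)" "1 \<le> i" "i < j" "j \<le> d" using f by (auto simp: arcs_def)
  have "0 \<le> long_flow b \<sigma> i"
    using \<sigma> dual_cost_nonneg[OF nonneg] by (auto simp: long_flow_def flippable_def)
  moreover have "long_flow b \<sigma> i \<le> b (i, i + 1)"
    using \<sigma> dual_cost_nonneg[OF nonneg, of i] ij partner_partner[of i]
    by (fastforce simp: long_flow_def flippable_def)
  ultimately show "0 \<le> flip_flow b \<sigma> f" using ij by (simp add: flip_flow_def)
next
  fix e assume "e \<in> path_tree d"
  then obtain k where k: "e = (k, k + 1)" "1 \<le> k" "k < d" by (auto simp: path_tree_def)
  \<comment> \<open>\<open>l\<close> is the first cut of the block of \<open>k\<close>; by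
    \<open>block\<close> below, \<open>(l, l + 2)\<close> is the only arc of length two with odd
    tail across cut \<open>k\<close>.\<close>
  define l where "l = (if odd k then k else k - 1)"
  have l: "odd l" "1 \<le> l" "l \<le> k" "k \<le> l + 1" and k_cases: "k = l \<or> k = l + 1"
    using k by (auto simp: l_def)
  have block: "l' = l" if "odd l'" "l' \<le> k" "k < l' + 2" for l'
    using that l k_cases by presburger
  have long: "long_flow b \<sigma> l = long_flow b \<sigma> k"
    using k_cases l \<sigma> by (auto simp: long_flow_def flippable_def partner_def)
  have other: "of_int (cutset_mat d e f) * flip_flow b \<sigma> f = 0"
    if f: "f \<in> arcs d" "f \<noteq> e" "f \<noteq> (l, l + 2)" for f
  proof -
    obtain i j where ij: "f = (i, j)" by (cases f)
    show ?thesis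
      using cutset_mat_eq[of k d i j] f k block[of i] by (auto simp: flip_flow_def ij)
  qed
  have e_val: "of_int (cutset_mat d e e) * flip_flow b \<sigma> e = b e - long_flow b \<sigma> k"
    using k by (auto simp: flip_flow_def cutset_mat_def path_tree_def)
  have eE: "e \<in> arcs d" using k by (auto simp: arcs_def)
  show "(\<Sum>f\<in>arcs d. of_int (cutset_mat d e f) * flip_flow b \<sigma> f) = b e"
  proof (cases "l + 2 \<le> d")
    case True
    then have lE: "(l, l + 2) \<in> arcs d" using l by (auto simp: arcs_def)
    have "of_int (cutset_mat d e (l, l + 2)) * flip_flow b \<sigma> (l, l + 2) = long_flow b \<sigma> k"
      using cutset_mat_eq[OF k(2,3) lE] l k long by (auto simp: flip_flow_def)
    moreover have "(\<Sum>f\<in>arcs d. of_int (cutset_mat d e f) * flip_flow b \<sigma> f) =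
        (\<Sum>f\<in>{e, (l, l + 2)}. of_int (cutset_mat d e f) * flip_flow b \<sigma> f)"
      using eE lE other by (intro sum.mono_neutral_right) auto
    ultimately show ?thesis using e_val k by simp
  next
    case False
    \<comment> \<open>Here \<open>k = l = d - 1\<close> is a last cut without a partner in the
      graph. Flippability keeps it out of \<open>\<sigma>\<close>, so nothing is rerouted.\<close>
    then have "k \<notin> \<sigma>" "partner k \<notin> \<sigma>"
      using \<sigma> k l k_cases by (fastforce simp: flippable_def partner_def)+
    then have "long_flow b \<sigma> k = 0" by (simp add: long_flow_def)
    moreover have "(l, l + 2) \<notin> arcs d" using False by (simp add: arcs_def)
    then have "(\<Sum>f\<in>arcs d. of_int (cutset_mat d e f) * flip_flow b \<sigma> f) =
        (\<Sum>f\<in>{e}. of_int (cutset_mat d e f) * flip_flow b \<sigma> f)"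
      using eE other by (intro sum.mono_neutral_right) auto
    ultimately show ?thesis using e_val by simp
  qed
qed

lemma flip_flow_supp:
  assumes "f \<in> arcs d - flip_tree d \<sigma>"
  shows "flip_flow b \<sigma> f = 0"
  using assms
  by (auto simp: flip_flow_def flip_tree_def arcs_def long_flow_def partner_def split: if_splits)

lemma flip_tree_subset: "flip_tree d \<sigma> \<subseteq> arcs d"
  by (auto simp: flip_tree_def arcs_def odd_pos Suc_leI)

text \<open>Every tree arc crosses cuts of one block only, so initial segments of the vertices
  isolate all arcs except a path arc left in a flipped block. The middle vertex of such a block is a
  leaf, and it or its complement is used, according to the direction of the arc.\<close>

lemma flip_tree_cuts:
  assumes e: "e \<in> flip_tree d \<sigma>"
  shows "\<exists>D. isolating_cut (flip_tree d \<sigma>) e D"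
proof -
  have block: "l' = (if odd k then k else k - 1)" if "odd l'" "l' \<le> k" "k < l' + 2" for l' k :: nat
    using that by presburger
  consider (short) k where "e = (k, k + 1)" "1 \<le> k" "k < d" "k \<notin> \<sigma>"
    | (long) l where "e = (l, l + 2)" "odd l" "l + 2 \<le> d" "l \<in> \<sigma> \<or> l + 1 \<in> \<sigma>"
    using e by (auto simp: flip_tree_def)
  then show ?thesis
  proof cases
    case short
    show ?thesis
    proof (cases "partner k \<in> \<sigma>")
      case True
      have "isolating_cut (flip_tree d \<sigma>) e (if odd k then - {k + 1} else {k})"
        using True short
        by (auto simp: isolating_cut_def flip_tree_def partner_def split: if_splits)
      then show ?thesis by blast
    next
      case False
      have "l \<le> k \<longleftrightarrow> l + 2 \<le> k" if "odd l" "l \<in> \<sigma> \<or> l + 1 \<in> \<sigma>" for l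
      proof (rule ccontr)
        assume "(l \<le> k) \<noteq> (l + 2 \<le> k)"
        then have "l = (if odd k then k else k - 1)" using that(1) by (intro block) auto
        then show False using that(2) False short by (auto simp: partner_def split: if_splits)
      qed
      then have "isolating_cut (flip_tree d \<sigma>) e {..k}"
        using short by (auto simp: isolating_cut_def flip_tree_def)
      then show ?thesis by blast
    qed
  next
    case long
    \<comment> \<open>A cut of the block whose path arc has been removed, so that only the long arc
      crosses it.\<close>
    define c where "c = (if l \<in> \<sigma> then l else l + 1)"
    have c: "c \<in> \<sigma>" "l \<le> c" "c < l + 2" using long by (auto simp: c_def)
    have long_arc: "l' \<le> c \<longleftrightarrow> l' + 2 \<le> c" if "odd l'" "l' \<noteq> l" for l'
    proof (rule ccontr)
      assume "(l' \<le> c) \<noteq> (l' + 2 \<le> c)"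
      then have "l' = l" using block[of l' c] block[of l c] that(1) c(2,3) long(2) by linarith
      then show False using that by simp
    qed
    have short_arc: "k \<le> c \<longleftrightarrow> k + 1 \<le> c" if "k \<notin> \<sigma>" for k
      using that c by (cases "k = c") auto
    have "isolating_cut (flip_tree d \<sigma>) e {..c}"
      unfolding isolating_cut_def
    proof (intro conjI ballI impI)
      fix f assume "f \<in> flip_tree d \<sigma>" "f \<noteq> e"
      then consider k where "f = (k, k + 1)" "k \<notin> \<sigma>" | l' where "f = (l', l' + 2)" "odd l'" "l' \<noteq> l"
        using long(1) by (auto simp: flip_tree_def)
      then show "fst f \<in> {..c} \<longleftrightarrow> snd f \<in> {..c}"
        using short_arc long_arc by cases simp_all
    qed (use long c in auto)
    then show ?thesis by blast
  qed
qed

text \<open>A removed path arc is bypassed along the other two sides of the triangle of its block: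
  the long arc and the path arc of the partner.\<close>

lemma flip_tree_connected:
  assumes \<sigma>: "flippable d b \<sigma>" and k: "1 \<le> k" "k < d"
  shows "(k, k + 1) \<in> (flip_tree d \<sigma> \<union> (flip_tree d \<sigma>)\<inverse>)\<^sup>*"
proof (cases "k \<in> \<sigma>")
  case False
  then show ?thesis using k by (auto simp: flip_tree_def)
next
  case True
  then have p: "partner k < d" "partner k \<notin> \<sigma>" using \<sigma> by (auto simp: flippable_def)
  let ?R = "flip_tree d \<sigma> \<union> (flip_tree d \<sigma>)\<inverse>"
  show ?thesis
  proof (cases "odd k")
    case True
    then have "(k, k + 2) \<in> ?R" "(k + 2, k + 1) \<in> ?R"
      using p k \<open>k \<in> \<sigma>\<close> by (auto simp: flip_tree_def partner_def)
    then show ?thesis by (meson r_into_rtrancl rtrancl.rtrancl_into_rtrancl)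
  next
    case False
    then have "(k, k - 1) \<in> ?R" "(k - 1, k + 1) \<in> ?R"
      using p k \<open>k \<in> \<sigma>\<close> by (auto simp: flip_tree_def partner_def)
    then show ?thesis by (meson r_into_rtrancl rtrancl.rtrancl_into_rtrancl)
  qed
qed

section \<open>The cheaper cuts of the complete blocks\<close>

definition smaller_cut :: "(arc \<Rightarrow> real) \<Rightarrow> nat \<Rightarrow> nat" where
  "smaller_cut b m = (if b (2 * m + 1, 2 * m + 2) \<le> b (2 * m + 2, 2 * m + 3) then 2 * m + 1 else 2 * m + 2)"

text \<open>\<open>(d - 1) div 2\<close> counts the blocks both of whose cuts are below
  \<open>d\<close>.\<close>

definition flip_set :: "nat \<Rightarrow> (arc \<Rightarrow> real) \<Rightarrow> nat set" where
  "flip_set d b = smaller_cut b ` {..<(d - 1) div 2}"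

lemma inj_smaller_cut: "inj (smaller_cut b)"
proof (rule injI)
  fix m n assume "smaller_cut b m = smaller_cut b n"
  then show "m = n" by (auto simp: smaller_cut_def split: if_splits)
qed

lemma card_flip_set: "card (flip_set d b) = (d - 1) div 2"
  unfolding flip_set_def by (subst card_image) (auto intro: inj_on_subset[OF inj_smaller_cut])

lemma flip_set_subset: "flip_set d b \<subseteq> {1..d - 1}"
  by (auto simp: flip_set_def smaller_cut_def)

text \<open>The block number \<open>(k - 1) div 2\<close> is shared by a cut and its partner, and
  the set contains one cut per block number; a partner in the set would equal the cut
  itself.\<close>

lemma flippable_flip_set:
  assumes "\<sigma> \<subseteq> flip_set d b"
  shows "flippable d b \<sigma>"
  unfolding flippable_def
proof
  fix k assume "k \<in> \<sigma>"
  then obtain m where m: "m < (d - 1) div 2" and k: "k = smaller_cut b m"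
    using assms by (auto simp: flip_set_def)
  have "partner k \<notin> flip_set d b"
  proof
    assume "partner k \<in> flip_set d b"
    then obtain n where n: "partner k = smaller_cut b n"
      by (auto simp: flip_set_def)
    have "(partner k - 1) div 2 = m" using k by (auto simp: partner_def smaller_cut_def)
    moreover have "(partner k - 1) div 2 = n" using n by (auto simp: smaller_cut_def)
    ultimately have "partner k = k" using n k by simp
    then show False using k by (auto simp: partner_def smaller_cut_def split: if_splits)
  qed
  then show "1 \<le> k \<and> k < d \<and> partner k < d \<and> partner k \<notin> \<sigma> \<and>
      b (k, k + 1) \<le> b (partner k, partner k + 1)"
    using assms k m by (auto simp: partner_def smaller_cut_def numeral_3_eq_3)
qed

text \<open>The set is read off from its tree as the cuts whose path arc is missing.\<close>

lemma flip_tree_inj: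
  assumes "\<sigma> \<subseteq> {1..d - 1}" "\<tau> \<subseteq> {1..d - 1}" "flip_tree d \<sigma> = flip_tree d \<tau>"
  shows "\<sigma> = \<tau>"
proof -
  have "k \<in> \<sigma> \<longleftrightarrow> (k, k + 1) \<notin> flip_tree d \<sigma>" "k \<in> \<tau> \<longleftrightarrow> (k, k + 1) \<notin> flip_tree d \<tau>"
    if "k \<in> {1..d - 1}" for k
    using that by (auto simp: flip_tree_def)
  then show ?thesis using assms by blast
qed

lemma flip_tree_standard_pair:
  assumes "dual_cost d b" "dual_generic d b" "nonneg_solvable d b" "\<sigma> \<subseteq> flip_set d b"
  shows "((1, arcs d - flip_tree d \<sigma>) :: (arc, 'k::field) mpoly \<times> arc set) \<in> dual_standard_pairs d b"
  using assms flippable_flip_set[OF assms(4)]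
  by (intro standard_pair_if_flow[where x = "flip_flow b \<sigma>"] flip_flow_feasible flip_flow_supp
      flip_tree_subset flip_tree_cuts)

theorem theorem5p7:
  shows "(\<forall>d\<ge>1. \<forall>b :: arc \<Rightarrow> real. dual_cost d b \<and> dual_generic d b \<and> nonneg_solvable d b \<longrightarrow>
      (\<exists>S \<subseteq> {1..d - 1}. card S \<ge> (d - 1) div 6 \<and>
        (\<exists>T :: nat set \<Rightarrow> arc set.
          (\<forall>\<sigma>. \<sigma> \<subseteq> S \<longrightarrow>
             spanning_tree d (T \<sigma>) \<and>
             {(i, i + 1) | i. i \<in> S - \<sigma>} \<subseteq> T \<sigma> \<and>
             T \<sigma> \<inter> {(j, j + 1) | j. j \<in> \<sigma>} = {} \<and>
             ((1, arcs d - T \<sigma>) :: (arc, 'k::field) mpoly \<times> arc set) \<in> dual_standard_pairs d b) \<and>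
          (\<forall>\<sigma> \<tau>. \<sigma> \<subseteq> S \<and> \<tau> \<subseteq> S \<and> \<sigma> \<noteq> \<tau> \<longrightarrow> T \<sigma> \<noteq> T \<tau>)))) \<and>
    (\<exists>C>0. \<exists>N. \<forall>d\<ge>N. \<forall>b :: arc \<Rightarrow> real. dual_cost d b \<and> dual_generic d b \<and> nonneg_solvable d b \<longrightarrow>
      (\<exists>P \<subseteq> (dual_standard_pairs d b :: ((arc, 'k) mpoly \<times> arc set) set).
        finite P \<and> real (card P) \<ge> C * 2 ^ (d div 6)))"
proof (intro conjI allI impI)
  fix d :: nat and b :: "arc \<Rightarrow> real"
  assume b: "dual_cost d b \<and> dual_generic d b \<and> nonneg_solvable d b"
  let ?S = "flip_set d b"
  have card: "(d - 1) div 6 \<le> card ?S"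
    unfolding card_flip_set by (rule div_le_mono2) simp_all
  have trees: "\<forall>\<sigma>. \<sigma> \<subseteq> ?S \<longrightarrow> spanning_tree d (flip_tree d \<sigma>) \<and>
      {(i, i + 1) | i. i \<in> ?S - \<sigma>} \<subseteq> flip_tree d \<sigma> \<and>
      flip_tree d \<sigma> \<inter> {(j, j + 1) | j. j \<in> \<sigma>} = {} \<and>
      ((1, arcs d - flip_tree d \<sigma>) :: (arc, 'k) mpoly \<times> arc set) \<in> dual_standard_pairs d b"
  proof (intro allI impI conjI)
    fix \<sigma> assume \<sigma>: "\<sigma> \<subseteq> ?S"
    show "spanning_tree d (flip_tree d \<sigma>)"
      using flippable_flip_set[OF \<sigma>]
      by (intro spanning_tree_if_cuts flip_tree_subset flip_tree_cuts flip_tree_connected)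
    show "{(i, i + 1) | i. i \<in> ?S - \<sigma>} \<subseteq> flip_tree d \<sigma>"
      using flip_set_subset[of d b] by (fastforce simp: flip_tree_def)
    show "flip_tree d \<sigma> \<inter> {(j, j + 1) | j. j \<in> \<sigma>} = {}"
      by (auto simp: flip_tree_def)
    show "((1, arcs d - flip_tree d \<sigma>) :: (arc, 'k) mpoly \<times> arc set) \<in> dual_standard_pairs d b"
      using b \<sigma> by (intro flip_tree_standard_pair) auto
  qed
  have inj: "\<forall>\<sigma> \<tau>. \<sigma> \<subseteq> ?S \<and> \<tau> \<subseteq> ?S \<and> \<sigma> \<noteq> \<tau> \<longrightarrow> flip_tree d \<sigma> \<noteq> flip_tree d \<tau>"
    using flip_tree_inj[of _ d] flip_set_subset[of d b] by (meson order_trans)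
  show "\<exists>S \<subseteq> {1..d - 1}. card S \<ge> (d - 1) div 6 \<and>
      (\<exists>T :: nat set \<Rightarrow> arc set.
        (\<forall>\<sigma>. \<sigma> \<subseteq> S \<longrightarrow>
           spanning_tree d (T \<sigma>) \<and>
           {(i, i + 1) | i. i \<in> S - \<sigma>} \<subseteq> T \<sigma> \<and>
           T \<sigma> \<inter> {(j, j + 1) | j. j \<in> \<sigma>} = {} \<and>
           ((1, arcs d - T \<sigma>) :: (arc, 'k) mpoly \<times> arc set) \<in> dual_standard_pairs d b) \<and>
        (\<forall>\<sigma> \<tau>. \<sigma> \<subseteq> S \<and> \<tau> \<subseteq> S \<and> \<sigma> \<noteq> \<tau> \<longrightarrow> T \<sigma> \<noteq> T \<tau>))"
    by (rule exI[of _ ?S], intro conjI exI[of _ "flip_tree d"] flip_set_subset card trees inj)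
next
  have "\<exists>P \<subseteq> (dual_standard_pairs d b :: ((arc, 'k) mpoly \<times> arc set) set).
      finite P \<and> real (card P) \<ge> 1 / 2 * 2 ^ (d div 6)"
    if b: "dual_cost d b \<and> dual_generic d b \<and> nonneg_solvable d b" for d :: nat and b :: "arc \<Rightarrow> real"
  proof -
    let ?S = "flip_set d b"
    let ?f = "\<lambda>\<sigma>. (1, arcs d - flip_tree d \<sigma>) :: (arc, 'k) mpoly \<times> arc set"
    let ?P = "?f ` Pow ?S"
    have inj: "inj_on ?f (Pow ?S)"
    proof (rule inj_onI)
      fix \<sigma> \<tau> assume st: "\<sigma> \<in> Pow ?S" "\<tau> \<in> Pow ?S" "?f \<sigma> = ?f \<tau>"
      \<comment> \<open>Both trees lie in \<open>arcs d\<close>, where complementation is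
        injective.\<close>
      then have "flip_tree d \<sigma> = flip_tree d \<tau>"
        using flip_tree_subset[of d \<sigma>] flip_tree_subset[of d \<tau>] by blast
      then show "\<sigma> = \<tau>" using st flip_set_subset[of d b] by (intro flip_tree_inj[of _ d]) auto
    qed
    have fin: "finite ?S" using flip_set_subset finite_atLeastAtMost by (rule finite_subset)
    have "card ?P = 2 ^ ((d - 1) div 2)"
      by (simp add: card_image[OF inj] card_Pow[OF fin] card_flip_set)
    \<comment> \<open>The extra 1 in the exponent absorbs the constant 1/2. The comparison of
      exponents holds for every \<open>d\<close>, including 0, which permits the threshold
      0.\<close>
    moreover have "(2::real) ^ (d div 6) \<le> 2 ^ ((d - 1) div 2 + 1)"
      by (rule power_increasing) auto
    ultimately have "real (card ?P) \<ge> 1 / 2 * 2 ^ (d div 6)" by simp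
    moreover have "?P \<subseteq> dual_standard_pairs d b"
      using b flip_tree_standard_pair[of d b] by auto
    moreover have "finite ?P" using fin by simp
    ultimately show ?thesis by blast
  qed
  then show "\<exists>C>0. \<exists>N. \<forall>d\<ge>N. \<forall>b :: arc \<Rightarrow> real. dual_cost d b \<and> dual_generic d b \<and> nonneg_solvable d b \<longrightarrow>
      (\<exists>P \<subseteq> (dual_standard_pairs d b :: ((arc, 'k) mpoly \<times> arc set) set).
        finite P \<and> real (card P) \<ge> C * 2 ^ (d div 6))"
    by (intro exI[of _ "1 / 2 :: real"] conjI exI[of _ "0 :: nat"]) auto
qed

end
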